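(* Let $G=(V,E)$ be a connected graph. Then: (i) The vertices of $\textsc{Bond}(G)$ are $\mathbf{0}$ and the vertices of $\textsc{Cut}(G)$ adjacent to $\mathbf{0}$ in $\textsc{Cut}(G)$. In particular, $\mathrm{cone}(\textsc{Cut}(G))=\mathrm{cone}(\textsc{Bond}(G))$. (ii) $\dim\textsc{Bond}(G)=|E|$. (iii) A homogeneous inequality $a^{\mathsf T}x\le 0$ is facet-defining for $\textsc{Bond}(G)$ if and only if it is facet-defining for $\textsc{Cut}(G)$.
   Context: For $S\subseteq V$, the cut $\delta(S)=\{e\in E:|e\cap S|=1\}$; it is a bond if $G[S]$ and $G[V\setminus S]$ are connected. $x^\delta\in\mathbb{R}^E$ is the incidence vector of $\delta$. $\textsc{Cut}(G)=\mathrm{conv}\{x^\delta:\delta\text{ a cut}\}$ and $\textsc{Bond}(G)=\mathrm{conv}\{x^\delta:\delta\text{ a bond}\}$. Two vertices of a polytope are adjacent if their convex hull is a $1$-dimensional face. $\mathrm{cone}(P)$ denotes the conical hull. Graphs are simple. *)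

theory Defs
  imports "HOL-Analysis.Analysis"
begin

definition simple_graph :: "'v set \<Rightarrow> 'v set set \<Rightarrow> bool" where
  "simple_graph V E \<longleftrightarrow> finite V \<and> (\<forall>e\<in>E. e \<subseteq> V \<and> card e = 2)"

text \<open>The graph without vertices counts as connected. Hence the empty cut (the case
  \<open>S = {}\<close> or \<open>S = V\<close>) of a connected graph is a bond, as is needed for the origin to
  belong to the bond polytope.\<close>

definition connected_graph :: "'v set \<Rightarrow> 'v set set \<Rightarrow> bool" where
  "connected_graph V E \<longleftrightarrow> (\<forall>u\<in>V. \<forall>v\<in>V. (u, v) \<in> {(x, y). {x, y} \<in> E}\<^sup>*)"

definition induced_edges :: "'v set set \<Rightarrow> 'v set \<Rightarrow> 'v set set" where
  "induced_edges E S = {e \<in> E. e \<subseteq> S}"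

definition cut :: "'v set set \<Rightarrow> 'v set \<Rightarrow> 'v set set" where
  "cut E S = {e \<in> E. card (e \<inter> S) = 1}"

definition cuts :: "'v set \<Rightarrow> 'v set set \<Rightarrow> 'v set set set" where
  "cuts V E = {cut E S | S. S \<subseteq> V}"

definition bonds :: "'v set \<Rightarrow> 'v set set \<Rightarrow> 'v set set set" where
  "bonds V E = {cut E S | S. S \<subseteq> V \<and> connected_graph S (induced_edges E S)
                              \<and> connected_graph (V - S) (induced_edges E (V - S))}"

text \<open>The space \<open>\<real>\<^sup>E\<close> is the coordinate subspace of the vectors, indexed by all sets of
  vertices, that vanish outside \<open>E\<close>; it has dimension \<open>card E\<close>, also if \<open>E\<close> is empty.\<close>

definition edge_space :: "'v::finite set set \<Rightarrow> (real ^ 'v set) set" where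
  "edge_space E = {x. \<forall>e. e \<notin> E \<longrightarrow> x $ e = 0}"

definition incidence_vec :: "'v::finite set set \<Rightarrow> real ^ 'v set" where
  "incidence_vec F = (\<chi> e. if e \<in> F then 1 else 0)"

definition cut_polytope :: "'v::finite set \<Rightarrow> 'v set set \<Rightarrow> (real ^ 'v set) set" where
  "cut_polytope V E = convex hull (incidence_vec ` cuts V E)"

definition bond_polytope :: "'v::finite set \<Rightarrow> 'v set set \<Rightarrow> (real ^ 'v set) set" where
  "bond_polytope V E = convex hull (incidence_vec ` bonds V E)"

definition adjacent_vertices :: "'a::euclidean_space set \<Rightarrow> 'a \<Rightarrow> 'a \<Rightarrow> bool" where
  "adjacent_vertices P x y \<longleftrightarrow> x extreme_point_of P \<and> y extreme_point_of P \<and>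
     convex hull {x, y} face_of P \<and> aff_dim (convex hull {x, y}) = 1"

definition facet_defining :: "'a::euclidean_space \<Rightarrow> real \<Rightarrow> 'a set \<Rightarrow> bool" where
  "facet_defining a b P \<longleftrightarrow> (\<forall>x\<in>P. a \<bullet> x \<le> b) \<and> {x \<in> P. a \<bullet> x = b} facet_of P"

end

theory Submission
  imports Defs
begin

text \<open>If one side of a cut of a connected graph induces a disconnected subgraph, splitting off a
  component writes the cut as a disjoint union of two smaller nonempty cuts. Iterating, every cut
  vector is a sum of bond vectors, so the two polytopes generate the same cone; this gives the
  dimension and the homogeneous facets. The splitting also shows that only bonds can be adjacent
  to the origin. Conversely, a cut contained in a bond is empty or the whole bond, so the sum of
  the coordinates outside a bond exposes the segment from the origin to the bond vector.\<close>

section \<open>Cuts and bonds\<close>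

lemma card_pair_Int_eq_1_iff:
  assumes "u \<noteq> v"
  shows "card ({u, v} \<inter> S) = 1 \<longleftrightarrow> (u \<in> S) \<noteq> (v \<in> S)"
  using assms by (cases "u \<in> S"; cases "v \<in> S") auto

lemma simple_graph_edgeE:
  assumes "simple_graph V E" and "e \<in> E"
  obtains u v where "e = {u, v}" "u \<noteq> v" "u \<in> V" "v \<in> V"
proof -
  have "e \<subseteq> V" "card e = 2"
    using assms by (auto simp: simple_graph_def)
  then show thesis
    using that by (metis card_2_iff insert_subset)
qed

lemma pair_in_cut_iff:
  assumes "simple_graph V E"
  shows "{u, v} \<in> cut E S \<longleftrightarrow> {u, v} \<in> E \<and> (u \<in> S) \<noteq> (v \<in> S)"
proof (cases "u = v")
  case True
  \<comment> \<open>For \<open>u = v\<close> the pair is a singleton, which is no edge of a simple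
    graph, so both sides are false.\<close>
  then have "{u, v} \<notin> E"
    using assms by (auto simp: simple_graph_def)
  then show ?thesis
    by (simp add: cut_def)
next
  case False
  then show ?thesis
    unfolding cut_def using card_pair_Int_eq_1_iff[OF False, of S] by blast
qed

lemma cut_eqI:
  assumes "simple_graph V E" and "A \<subseteq> E"
    and "\<And>u v. \<lbrakk>{u, v} \<in> E; u \<noteq> v; u \<in> V; v \<in> V\<rbrakk> \<Longrightarrow>
           {u, v} \<in> A \<longleftrightarrow> (u \<in> S) \<noteq> (v \<in> S)"
  shows "cut E S = A"
proof (rule set_eqI)
  fix e
  show "e \<in> cut E S \<longleftrightarrow> e \<in> A"
  proof (cases "e \<in> E")
    case True
    then obtain u v where "e = {u, v}" "u \<noteq> v" "u \<in> V" "v \<in> V"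
      using simple_graph_edgeE[OF assms(1)] by blast
    then show ?thesis
      using True assms(3) pair_in_cut_iff[OF assms(1)] by metis
  next
    case False
    then show ?thesis
      using assms(2) by (auto simp: cut_def)
  qed
qed

lemma cut_subset: "cut E S \<subseteq> E"
  by (auto simp: cut_def)

lemma cut_empty [simp]: "cut E {} = {}"
  by (simp add: cut_def)

lemma cut_complement:
  assumes "simple_graph V E"
  shows "cut E (V - S) = cut E S"
  by (intro cut_eqI[OF assms cut_subset]) (auto simp: pair_in_cut_iff[OF assms])

text \<open>A walk can leave \<open>T\<close> only along an edge of \<open>cut E T\<close>.\<close>

lemma reachable_closed_if_cut_empty:
  assumes "simple_graph V E" and "cut E T = {}"
    and "(u, v) \<in> {(x, y). {x, y} \<in> E}\<^sup>*" and "u \<in> T"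
  shows "v \<in> T"
  using assms(3,4)
proof (induction rule: rtrancl_induct)
  case (step y z)
  then show ?case
    using assms(2) pair_in_cut_iff[OF assms(1), of y z T] by auto
qed

lemma connected_graph_cut_nonempty:
  assumes "simple_graph V E" and "connected_graph V E"
    and "T \<subseteq> V" "T \<noteq> {}" "T \<noteq> V"
  shows "cut E T \<noteq> {}"
proof
  assume "cut E T = {}"
  obtain u v where "u \<in> T" "v \<in> V" "v \<notin> T"
    using assms(3-5) by blast
  moreover have "(u, v) \<in> {(x, y). {x, y} \<in> E}\<^sup>*"
    using assms(2,3) calculation by (auto simp: connected_graph_def)
  ultimately show False
    using reachable_closed_if_cut_empty[OF assms(1) \<open>cut E T = {}\<close>] by blast
qed

lemma simple_graph_induced_edges:
  assumes "simple_graph V E"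
  shows "simple_graph V (induced_edges E S)"
  using assms by (auto simp: simple_graph_def induced_edges_def)

text \<open>An edge inside \<open>S\<close> does not lie in \<open>cut E S\<close>, hence not in the
  smaller \<open>cut E T\<close>. So no edge of the connected graph induced on \<open>S\<close>
  crosses \<open>T\<close>, and \<open>T\<close> cannot split \<open>S\<close>.\<close>

lemma connected_side_of_subcut:
  assumes "simple_graph V E" and "connected_graph S (induced_edges E S)"
    and "cut E T \<subseteq> cut E S"
  shows "S \<inter> T = {} \<or> S \<subseteq> T"
proof -
  have "cut (induced_edges E S) T = {}"
  proof (intro cut_eqI[OF simple_graph_induced_edges[OF assms(1)]])
    fix u v assume uv: "{u, v} \<in> induced_edges E S"
    then have "{u, v} \<notin> cut E T"
      using assms(3) pair_in_cut_iff[OF assms(1)] by (auto simp: induced_edges_def)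
    then show "{u, v} \<in> {} \<longleftrightarrow> (u \<in> T) \<noteq> (v \<in> T)"
      using uv pair_in_cut_iff[OF assms(1)] by (auto simp: induced_edges_def)
  qed simp
  then have "v \<in> T" if "u \<in> S" "v \<in> S" "u \<in> T" for u v
    using reachable_closed_if_cut_empty[OF simple_graph_induced_edges[OF assms(1)]] that assms(2)
    unfolding connected_graph_def by blast
  then show ?thesis
    by blast
qed

text \<open>Minimality of bonds: each side of the bond is connected, so \<open>T\<close> contains or
  misses it entirely. This leaves four candidates for \<open>T\<close>.\<close>

lemma cut_subset_bond:
  assumes "simple_graph V E" and "D \<in> cuts V E" and "B \<in> bonds V E" and "D \<subseteq> B"
  shows "D = {} \<or> D = B"
proof -
  obtain T where T: "T \<subseteq> V" "D = cut E T"
    using assms(2) by (auto simp: cuts_def)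
  obtain S where S: "S \<subseteq> V" "B = cut E S" "connected_graph S (induced_edges E S)"
      "connected_graph (V - S) (induced_edges E (V - S))"
    using assms(3) by (auto simp: bonds_def)
  have "S \<inter> T = {} \<or> S \<subseteq> T"
    using connected_side_of_subcut[OF assms(1) S(3)] assms(4) T S by simp
  moreover have "(V - S) \<inter> T = {} \<or> V - S \<subseteq> T"
    using connected_side_of_subcut[OF assms(1) S(4)] assms(4) T S cut_complement[OF assms(1)]
    by simp
  \<comment> \<open>Writing \<open>V\<close> as \<open>V - {}\<close> lets
    \<open>cut_complement\<close> treat it like the empty side, whose cut is empty.\<close>
  ultimately have "T = {} \<or> T = S \<or> T = V - S \<or> T = V - {}"
    using T(1) S(1) by blast
  then show ?thesis
    using T S cut_complement[OF assms(1)] cut_empty by metis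
qed

text \<open>Let \<open>T\<close> be the component of \<open>u\<close> in the graph induced on
  \<open>S\<close>. No edge joins \<open>T\<close> to \<open>S - T\<close>, so each edge leaving
  \<open>S\<close> leaves exactly one of them, and the two cuts partition \<open>cut E S\<close>.
  Both are nonempty since the whole graph is connected.\<close>

lemma cut_split_if_disconnected:
  assumes "simple_graph V E" and "connected_graph V E"
    and "S \<subseteq> V" and "\<not> connected_graph S (induced_edges E S)"
  obtains D1 D2 where "D1 \<in> cuts V E" "D2 \<in> cuts V E" "D1 \<noteq> {}" "D2 \<noteq> {}"
    "D1 \<inter> D2 = {}" "cut E S = D1 \<union> D2"
proof -
  define R where "R = {(x, y). {x, y} \<in> induced_edges E S}"
  obtain u v where uv: "u \<in> S" "v \<in> S" "(u, v) \<notin> R\<^sup>*"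
    using assms(4) by (auto simp: connected_graph_def R_def)
  define T where "T = {w \<in> S. (u, w) \<in> R\<^sup>*}"
  have T: "T \<subseteq> S" "u \<in> T" "v \<in> S - T"
    using uv by (auto simp: T_def)
  have step: "y \<in> T" if "x \<in> T" "y \<in> S" "{x, y} \<in> E" for x y
  proof -
    have "(x, y) \<in> R"
      using that T(1) by (auto simp: R_def induced_edges_def)
    then show ?thesis
      using that by (auto simp: T_def intro: rtrancl_into_rtrancl)
  qed
  have sep: "x \<in> T \<longleftrightarrow> y \<in> T" if "{x, y} \<in> E" "x \<in> S" "y \<in> S" for x y
    using step[of x y] step[of y x] that by (auto simp: insert_commute)
  show thesis
  proof
    show "cut E T \<in> cuts V E" "cut E (S - T) \<in> cuts V E"
      using T(1) assms(3) by (auto simp: cuts_def)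
    show "cut E T \<noteq> {}"
      using T assms by (intro connected_graph_cut_nonempty[OF assms(1,2)]) auto
    show "cut E (S - T) \<noteq> {}"
      using T assms by (intro connected_graph_cut_nonempty[OF assms(1,2)]) auto
    show "cut E T \<inter> cut E (S - T) = {}"
    proof (rule ccontr)
      assume "cut E T \<inter> cut E (S - T) \<noteq> {}"
      then obtain e where e: "e \<in> cut E T" "e \<in> cut E (S - T)"
        by blast
      obtain x y where xy: "e = {x, y}"
        using e cut_subset simple_graph_edgeE[OF assms(1)] by (metis subsetD)
      show False
        using e sep[of x y] T(1) unfolding xy pair_in_cut_iff[OF assms(1)] by blast
    qed
    show "cut E S = cut E T \<union> cut E (S - T)"
    proof (rule cut_eqI[OF assms(1)])
      show "cut E T \<union> cut E (S - T) \<subseteq> E"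
        using cut_subset by blast
      fix x y assume "{x, y} \<in> E"
      then show "{x, y} \<in> cut E T \<union> cut E (S - T) \<longleftrightarrow> (x \<in> S) \<noteq> (y \<in> S)"
        using sep[of x y] T(1) by (auto simp: pair_in_cut_iff[OF assms(1)])
    qed
  qed
qed

lemma nonbond_cut_split:
  assumes "simple_graph V E" and "connected_graph V E"
    and "D \<in> cuts V E" and "D \<notin> bonds V E"
  obtains D1 D2 where "D1 \<in> cuts V E" "D2 \<in> cuts V E" "D1 \<noteq> {}" "D2 \<noteq> {}"
    "D1 \<inter> D2 = {}" "D = D1 \<union> D2"
proof -
  obtain S where S: "S \<subseteq> V" "D = cut E S"
    using assms(3) by (auto simp: cuts_def)
  have "\<not> connected_graph S (induced_edges E S) \<or>
        \<not> connected_graph (V - S) (induced_edges E (V - S))"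
    using assms(4) S by (auto simp: bonds_def)
  then show thesis
  proof
    assume "\<not> connected_graph S (induced_edges E S)"
    then show thesis
      using cut_split_if_disconnected[OF assms(1,2) S(1)] S(2) that by metis
  next
    assume "\<not> connected_graph (V - S) (induced_edges E (V - S))"
    then show thesis
      using cut_split_if_disconnected[OF assms(1,2) Diff_subset] S(2) that
        cut_complement[OF assms(1)] by metis
  qed
qed

lemma bonds_subset_cuts: "bonds V E \<subseteq> cuts V E"
  by (auto simp: bonds_def cuts_def)

text \<open>The witness is the empty side: it counts as connected, and its complement induces the
  whole graph.\<close>

lemma empty_in_bonds:
  assumes "simple_graph V E" and "connected_graph V E"
  shows "{} \<in> bonds V E"
proof -
  have "induced_edges E V = E"
    using assms(1) by (auto simp: induced_edges_def simple_graph_def)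
  then have "cut E {} \<in> bonds V E"
    unfolding bonds_def using assms(2)
    by (auto simp: connected_graph_def intro!: exI[of _ "{}"])
  then show ?thesis
    by simp
qed

section \<open>Incidence vectors\<close>

lemma incidence_vec_nth: "incidence_vec F $ e = (if e \<in> F then 1 else 0)"
  by (simp add: incidence_vec_def)

lemma incidence_vec_empty [simp]: "incidence_vec {} = 0"
  by (simp add: vec_eq_iff incidence_vec_nth)

lemma incidence_vec_eq_iff [simp]: "incidence_vec F = incidence_vec F' \<longleftrightarrow> F = F'"
  by (auto simp: vec_eq_iff incidence_vec_nth split: if_splits)

lemma incidence_vec_eq_0_iff [simp]: "incidence_vec F = 0 \<longleftrightarrow> F = {}"
  using incidence_vec_eq_iff[of F "{}"] by (simp del: incidence_vec_eq_iff)

lemma incidence_vec_disjoint_Un: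
  assumes "F \<inter> F' = {}"
  shows "incidence_vec (F \<union> F') = incidence_vec F + incidence_vec F'"
  using assms by (auto simp: vec_eq_iff incidence_vec_nth)

lemma convex_hull_incidence_vec_bounds:
  assumes "x \<in> convex hull (incidence_vec ` \<F>)"
  shows "0 \<le> x $ e" and "x $ e \<le> 1"
proof -
  have "convex hull (incidence_vec ` \<F>) \<subseteq> cbox 0 1"
    by (rule hull_minimal) (auto simp: mem_box_cart incidence_vec_nth)
  then show "0 \<le> x $ e" and "x $ e \<le> 1"
    using assms by (auto simp: mem_box_cart)
qed

text \<open>The hull lies in the unit cube, and 0/1 vectors are corners of the cube. At a corner
  every coordinate is extremal, so the ends of a segment through it agree in every
  coordinate.\<close>

lemma extreme_point_of_convex_hull_incidence_vec:
  "x extreme_point_of convex hull (incidence_vec ` \<F>) \<longleftrightarrow> x \<in> incidence_vec ` \<F>"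
proof
  assume "x \<in> incidence_vec ` \<F>"
  then obtain F where F: "F \<in> \<F>" "x = incidence_vec F"
    by blast
  have "x \<notin> open_segment a b"
    if ab: "a \<in> convex hull (incidence_vec ` \<F>)" "b \<in> convex hull (incidence_vec ` \<F>)" for a b
  proof
    assume "x \<in> open_segment a b"
    then obtain u where u: "a \<noteq> b" "0 < u" "u < 1" "x = (1 - u) *\<^sub>R a + u *\<^sub>R b"
      by (auto simp: in_segment)
    have "a $ e = b $ e" for e
    proof -
      have x: "x $ e = (1 - u) * a $ e + u * b $ e"
        using u(4) by simp
      note bounds = convex_hull_incidence_vec_bounds[OF ab(1), of e]
        convex_hull_incidence_vec_bounds[OF ab(2), of e]
      show ?thesis
      proof (cases "e \<in> F")
        case True
        \<comment> \<open>Measured from the upper bound 1, two nonnegative terms add up to 0, so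
          both vanish; as \<open>0 < u < 1\<close>, both ends have coordinate 1.\<close>
        then have "(1 - u) * (1 - a $ e) + u * (1 - b $ e) = 0"
          using x F(2) by (simp add: incidence_vec_nth algebra_simps)
        moreover have "0 \<le> (1 - u) * (1 - a $ e)" "0 \<le> u * (1 - b $ e)"
          using u bounds by simp_all
        ultimately have "(1 - u) * (1 - a $ e) = 0" "u * (1 - b $ e) = 0"
          by linarith+
        then show ?thesis
          using u by simp
      next
        case False
        then have "(1 - u) * a $ e + u * b $ e = 0"
          using x F(2) by (simp add: incidence_vec_nth)
        moreover have "0 \<le> (1 - u) * a $ e" "0 \<le> u * b $ e"
          using u bounds by simp_all
        ultimately have "(1 - u) * a $ e = 0" "u * b $ e = 0"
          by linarith+
        then show ?thesis
          using u by simp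
      qed
    qed
    then show False
      using u(1) by (simp add: vec_eq_iff)
  qed
  moreover have "x \<in> convex hull (incidence_vec ` \<F>)"
    using F by (simp add: hull_inc)
  ultimately show "x extreme_point_of convex hull (incidence_vec ` \<F>)"
    by (auto simp: extreme_point_of_def)
qed (rule extreme_point_of_convex_hull)

text \<open>Points of the segment are multiples of the vector of \<open>D\<close>. Any element of
  \<open>F\<close> gives a coordinate equal to 1, which forces the factor to be 1.\<close>

lemma incidence_vec_in_segment_0:
  assumes "incidence_vec F \<in> convex hull {0, incidence_vec D}"
  shows "F = {} \<or> F = D"
proof (rule disjCI)
  assume "F \<noteq> D"
  obtain u where u: "incidence_vec F = u *\<^sub>R incidence_vec D"
    using assms by (auto simp: segment_convex_hull[symmetric] in_segment)
  have "u = 1" if "e \<in> F" for e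
    using arg_cong[OF u, of "\<lambda>x. x $ e"] that by (auto simp: incidence_vec_nth split: if_splits)
  then show "F = {}"
    using u \<open>F \<noteq> D\<close> by (cases "F = {}") auto
qed

section \<open>The cone and the dimension\<close>

text \<open>Induction on the size of the cut: a cut that is no bond splits into two strictly smaller
  cuts, whose vectors add up because they are disjoint.\<close>

lemma incidence_vec_cut_in_bond_cone:
  assumes "simple_graph V E" and "connected_graph V E" and "D \<in> cuts V E"
  shows "incidence_vec D \<in> convex_cone hull (incidence_vec ` bonds V E)"
  using assms(3)
proof (induction "card D" arbitrary: D rule: less_induct)
  case less
  show ?case
  proof (cases "D \<in> bonds V E")
    case True
    then show ?thesis
      by (simp add: hull_inc)
  next
    case False
    then obtain D1 D2 where D: "D1 \<in> cuts V E" "D2 \<in> cuts V E" "D1 \<noteq> {}" "D2 \<noteq> {}"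
        "D1 \<inter> D2 = {}" "D = D1 \<union> D2"
      using nonbond_cut_split[OF assms(1,2) less.prems] by metis
    then have "D1 \<subset> D" "D2 \<subset> D"
      by blast+
    then have "card D1 < card D" "card D2 < card D"
      by (auto intro: psubset_card_mono)
    then show ?thesis
      using less.hyps D by (simp add: incidence_vec_disjoint_Un convex_cone_hull_add)
  qed
qed

text \<open>Reduces comparing the cones of the two polytopes to comparing those of their
  generators.\<close>

lemma convex_cone_hull_of_convex_hull: "convex_cone hull (convex hull S) = convex_cone hull S"
  by (simp add: convex_cone_hull_separate)

lemma cut_cone_eq_bond_cone:
  assumes "simple_graph V E" and "connected_graph V E"
  shows "convex_cone hull (cut_polytope V E) = convex_cone hull (bond_polytope V E)"
proof -
  have "convex_cone hull (incidence_vec ` cuts V E) = convex_cone hull (incidence_vec ` bonds V E)"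
  proof
    show "convex_cone hull (incidence_vec ` cuts V E) \<subseteq> convex_cone hull (incidence_vec ` bonds V E)"
      using incidence_vec_cut_in_bond_cone[OF assms]
      by (intro hull_minimal) (auto simp: convex_cone_convex_cone_hull)
    show "convex_cone hull (incidence_vec ` bonds V E) \<subseteq> convex_cone hull (incidence_vec ` cuts V E)"
      using bonds_subset_cuts by (intro hull_mono image_mono)
  qed
  then show ?thesis
    by (simp add: cut_polytope_def bond_polytope_def convex_cone_hull_of_convex_hull)
qed

text \<open>A point of the cone is \<open>c *\<^sub>R y\<close> with \<open>y\<close> in
  \<open>P\<close>. Either \<open>c = 0\<close> and the point is the origin, or \<open>y\<close>
  lies on the same homogeneous hyperplane, so passing to the cone does not enlarge the span.\<close>

lemma span_homogeneous_section_cone: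
  fixes P :: "'a::euclidean_space set"
  assumes "convex P" and "P \<noteq> {}"
  shows "span {x \<in> convex_cone hull P. a \<bullet> x = 0} = span {x \<in> P. a \<bullet> x = 0}"
proof
  have "x \<in> span {x \<in> P. a \<bullet> x = 0}" if x: "x \<in> convex_cone hull P" "a \<bullet> x = 0" for x
  proof -
    obtain c y where y: "y \<in> P" "x = c *\<^sub>R y"
      using x(1) assms by (auto simp: convex_cone_hull_convex_hull_nonempty hull_same)
    show ?thesis
    proof (cases "c = 0")
      case True
      then show ?thesis
        using y by (simp add: span_zero)
    next
      case False
      then show ?thesis
        using y x(2) by (auto intro: span_scale span_base)
    qed
  qed
  then show "span {x \<in> convex_cone hull P. a \<bullet> x = 0} \<subseteq> span {x \<in> P. a \<bullet> x = 0}"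
    by (intro span_minimal) auto
  show "span {x \<in> P. a \<bullet> x = 0} \<subseteq> span {x \<in> convex_cone hull P. a \<bullet> x = 0}"
    by (intro span_mono) (auto intro: hull_inc)
qed

text \<open>The span of a section depends only on the cone, and since each section contains the
  origin, its affine dimension is the dimension of its span.\<close>

lemma aff_dim_homogeneous_section:
  fixes P Q :: "'a::euclidean_space set"
  assumes "convex P" "0 \<in> P" "convex Q" "0 \<in> Q"
    and "convex_cone hull P = convex_cone hull Q"
  shows "aff_dim {x \<in> P. a \<bullet> x = 0} = aff_dim {x \<in> Q. a \<bullet> x = 0}"
proof -
  have "span {x \<in> P. a \<bullet> x = 0} = span {x \<in> Q. a \<bullet> x = 0}"
    using assms span_homogeneous_section_cone[of P a] span_homogeneous_section_cone[of Q a]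
    by auto
  then have "dim {x \<in> P. a \<bullet> x = 0} = dim {x \<in> Q. a \<bullet> x = 0}"
    using dim_span[of "{x \<in> P. a \<bullet> x = 0}"] dim_span[of "{x \<in> Q. a \<bullet> x = 0}"] by simp
  then show ?thesis
    using assms by (simp add: aff_dim_zero hull_inc)
qed

text \<open>Validity can be read off the cone because a homogeneous halfspace is a convex cone.
  Validity makes the section a face, and the dimensions of section and polytope depend only on the
  cone as well.\<close>

lemma facet_defining_homogeneous_cong:
  fixes P Q :: "'a::euclidean_space set"
  assumes "convex P" "0 \<in> P" "convex Q" "0 \<in> Q"
    and "convex_cone hull P = convex_cone hull Q"
  shows "facet_defining a 0 P \<longleftrightarrow> facet_defining a 0 Q"
proof -
  have valid: "(\<forall>x\<in>R. a \<bullet> x \<le> 0) \<longleftrightarrow> convex_cone hull R \<subseteq> {x. a \<bullet> x \<le> 0}" for R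
    using hull_subset[of R convex_cone] hull_minimal[of R "{x. a \<bullet> x \<le> 0}" convex_cone]
      convex_cone_halfspace_le[of a] by auto
  have face: "{x \<in> R. a \<bullet> x = 0} face_of R" if "convex R" "\<forall>x\<in>R. a \<bullet> x \<le> 0" for R
    using face_of_Int_supporting_hyperplane_le[of R a 0] that by (simp add: Int_def)
  \<comment> \<open>The section by the zero functional is the whole set.\<close>
  have "aff_dim P = aff_dim Q"
    using aff_dim_homogeneous_section[OF assms, of 0] by simp
  then show ?thesis
    using assms valid[of P] valid[of Q] face[of P] face[of Q] aff_dim_homogeneous_section[OF assms, of a]
    unfolding facet_defining_def facet_of_def by auto
qed

section \<open>The linear span of the cut vectors\<close>

lemma dim_edge_space: "dim (edge_space E) = card E"
proof -
  let ?d = "(\<lambda>e. axis e (1::real)) ` E"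
  have "edge_space E = {x. \<forall>i\<in>Basis. i \<notin> ?d \<longrightarrow> x \<bullet> i = 0}"
    by (auto simp: edge_space_def Basis_vec_def inner_axis axis_eq_axis image_iff)
  moreover have "?d \<subseteq> Basis"
    by auto
  moreover have "card ?d = card E"
    by (intro card_image) (auto simp: inj_on_def axis_eq_axis)
  ultimately show ?thesis
    using dim_substandard[of ?d] by simp
qed

lemma edge_space_subset_span_cuts:
  assumes "simple_graph V E"
  shows "edge_space E \<subseteq> span (incidence_vec ` cuts V E)"
proof
  fix x :: "real ^ 'a set" assume x: "x \<in> edge_space E"
  have "axis e 1 \<in> span (incidence_vec ` cuts V E)" if "e \<in> E" for e
  proof -
    obtain u v where uv: "e = {u, v}" "u \<noteq> v" "u \<in> V" "v \<in> V"
      using simple_graph_edgeE[OF assms \<open>e \<in> E\<close>] by metis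
    let ?\<chi> = "\<lambda>S. incidence_vec (cut E S)"
    \<comment> \<open>The edge \<open>{u, v}\<close> lies in the cuts of \<open>{u}\<close> and
      \<open>{v}\<close> but not in that of \<open>{u, v}\<close>, giving 2. Any other edge meeting
      \<open>{u, v}\<close> lies in one of the first two cuts and in the third, giving 0.\<close>
    have eq: "axis e 1 = (1/2) *\<^sub>R (?\<chi> {u} + ?\<chi> {v} - ?\<chi> {u, v})"
    proof (rule vec_eq_iff[THEN iffD2], rule allI)
      fix f
      show "axis e (1::real) $ f = ((1/2) *\<^sub>R (?\<chi> {u} + ?\<chi> {v} - ?\<chi> {u, v})) $ f"
      proof (cases "f \<in> E")
        case True
        then obtain a b where "f = {a, b}" "a \<noteq> b"
          using simple_graph_edgeE[OF assms] by metis
        then show ?thesis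
          using True uv
          by (auto simp: axis_def incidence_vec_nth pair_in_cut_iff[OF assms] doubleton_eq_iff)
      next
        case False
        then have "f \<noteq> e" "f \<notin> cut E S" for S
          using that cut_subset by blast+
        then show ?thesis
          by (simp add: axis_def incidence_vec_nth)
      qed
    qed
    have "cut E {u} \<in> cuts V E" "cut E {v} \<in> cuts V E" "cut E {u, v} \<in> cuts V E"
      using uv by (auto simp: cuts_def)
    then show ?thesis
      unfolding eq by (intro span_scale span_diff span_add span_base imageI)
  qed
  then have "x $ e *\<^sub>R axis e 1 \<in> span (incidence_vec ` cuts V E)" for e
    using x by (cases "e \<in> E") (auto simp: edge_space_def span_zero intro: span_scale)
  then have "(\<Sum>e\<in>UNIV. x $ e *\<^sub>R axis e 1) \<in> span (incidence_vec ` cuts V E)"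
    by (intro span_sum)
  then show "x \<in> span (incidence_vec ` cuts V E)"
    using basis_expansion[of x] by (simp add: scalar_mult_eq_scaleR)
qed

lemma span_cuts:
  assumes "simple_graph V E"
  shows "span (incidence_vec ` cuts V E) = edge_space E"
proof
  show "span (incidence_vec ` cuts V E) \<subseteq> edge_space E"
    by (intro span_minimal)
       (auto simp: edge_space_def subspace_def incidence_vec_nth cuts_def cut_def)
qed (rule edge_space_subset_span_cuts[OF assms])

lemma zero_in_bond_polytope:
  assumes "simple_graph V E" and "connected_graph V E"
  shows "0 \<in> bond_polytope V E"
  unfolding bond_polytope_def
  using empty_in_bonds[OF assms] by (intro hull_inc) (force simp: image_iff)

lemma bond_polytope_subset_cut_polytope: "bond_polytope V E \<subseteq> cut_polytope V E"
  unfolding bond_polytope_def cut_polytope_def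
  using bonds_subset_cuts by (intro hull_mono image_mono)

lemma aff_dim_bond_polytope:
  assumes "simple_graph V E" and "connected_graph V E"
  shows "aff_dim (bond_polytope V E) = int (card E)"
proof -
  have 0: "0 \<in> bond_polytope V E" "0 \<in> cut_polytope V E"
    using zero_in_bond_polytope[OF assms] bond_polytope_subset_cut_polytope by blast+
  \<comment> \<open>Sections by the zero functional again: equal cones give equal
    dimensions.\<close>
  have "aff_dim (bond_polytope V E) = aff_dim (cut_polytope V E)"
    using aff_dim_homogeneous_section[OF _ 0(1) _ 0(2), of 0] cut_cone_eq_bond_cone[OF assms]
    by (simp add: bond_polytope_def cut_polytope_def)
  also have "\<dots> = aff_dim (incidence_vec ` cuts V E)"
    by (simp add: cut_polytope_def aff_dim_convex_hull)
  also have "\<dots> = int (dim (incidence_vec ` cuts V E))"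
    using 0(2) convex_hull_subset_affine_hull unfolding cut_polytope_def
    by (intro aff_dim_zero) blast
  also have "\<dots> = int (card E)"
    using span_cuts[OF assms(1)] dim_edge_space[of E] by (metis dim_span)
  finally show ?thesis .
qed

section \<open>Adjacency to the origin\<close>

lemma segment_to_bond_face_of_cut_polytope:
  assumes "simple_graph V E" and "connected_graph V E" and "B \<in> bonds V E"
  shows "convex hull {0, incidence_vec B} face_of cut_polytope V E"
proof -
  \<comment> \<open>Pairing with \<open>c\<close> yields minus the sum of the coordinates outside
    \<open>B\<close>, which is at most 0 on the cut polytope.\<close>
  define c :: "real ^ 'a set" where "c = - incidence_vec (- B)"
  have c: "c \<bullet> x = - (\<Sum>e\<in>- B. x $ e)" for x
    by (simp add: c_def inner_vec_def incidence_vec_nth if_distrib if_distribR sum.If_cases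
        sum.inter_restrict[symmetric] Compl_eq sum_negf cong: if_cong)
  have nonpos: "c \<bullet> x \<le> 0" if "x \<in> cut_polytope V E" for x
    using that convex_hull_incidence_vec_bounds(1) unfolding c cut_polytope_def
    by (auto intro!: sum_nonneg)
  define F where "F = cut_polytope V E \<inter> {x. c \<bullet> x = 0}"
  have face: "F face_of cut_polytope V E"
    unfolding F_def
    by (intro face_of_Int_supporting_hyperplane_le nonpos) (auto simp: cut_polytope_def)
  moreover have "compact (incidence_vec ` cuts V E)"
    by (simp add: finite_imp_compact)
  \<comment> \<open>A face of the hull of finitely many points is the hull of some of them, so only
    cut vectors have to be examined.\<close>
  ultimately obtain X where X: "X \<subseteq> incidence_vec ` cuts V E" "F = convex hull X"
    unfolding cut_polytope_def by (metis face_of_convex_hull_subset)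
  have "x = 0 \<or> x = incidence_vec B" if x: "x \<in> X" for x
  proof -
    obtain D where D: "D \<in> cuts V E" "x = incidence_vec D"
      using X(1) x by blast
    have "x \<in> F"
      using X(2) x by (simp add: hull_inc)
    then have "(\<Sum>e\<in>- B. x $ e) = 0"
      by (simp add: F_def c)
    \<comment> \<open>Nonnegative coordinates with sum 0 all vanish, so \<open>D\<close> is
      contained in \<open>B\<close>, and minimality of bonds applies.\<close>
    then have "\<forall>e\<in>- B. x $ e = 0"
      using D(2) by (subst (asm) sum_nonneg_eq_0_iff) (auto simp: incidence_vec_nth)
    then have "D \<subseteq> B"
      using D(2) by (auto simp: incidence_vec_nth split: if_splits)
    then show ?thesis
      using cut_subset_bond[OF assms(1) D(1) assms(3)] D(2) by auto
  qed
  then have "F \<subseteq> convex hull {0, incidence_vec B}"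
    unfolding X(2) by (intro hull_mono) blast
  moreover have "convex hull {0, incidence_vec B} \<subseteq> F"
  proof (rule hull_minimal)
    have "0 \<in> cut_polytope V E"
      using zero_in_bond_polytope[OF assms(1,2)] bond_polytope_subset_cut_polytope by blast
    moreover have "incidence_vec B \<in> cut_polytope V E"
      using assms(3) bonds_subset_cuts unfolding cut_polytope_def by (intro hull_inc) blast
    moreover have "c \<bullet> incidence_vec B = 0"
      unfolding c by (simp add: incidence_vec_nth)
    ultimately show "{0, incidence_vec B} \<subseteq> F"
      by (simp add: F_def)
    show "convex F"
      using X(2) by simp
  qed
  ultimately show ?thesis
    using face by simp
qed

text \<open>If \<open>D\<close> splits into \<open>D1\<close> and \<open>D2\<close>, the segments
  from 0 to \<open>D\<close> and from \<open>D1\<close> to \<open>D2\<close> share their midpoint. A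
  face containing it contains the vector of \<open>D1\<close>, yet the only 0/1 vectors on the first
  segment are its ends.\<close>

lemma adjacent_0_imp_bond:
  assumes "simple_graph V E" and "connected_graph V E"
    and "D \<in> cuts V E" and "convex hull {0, incidence_vec D} face_of cut_polytope V E"
  shows "D \<in> bonds V E"
proof (rule ccontr)
  assume "D \<notin> bonds V E"
  then obtain D1 D2 where D: "D1 \<in> cuts V E" "D2 \<in> cuts V E" "D1 \<noteq> {}" "D2 \<noteq> {}"
      "D1 \<inter> D2 = {}" "D = D1 \<union> D2"
    using nonbond_cut_split[OF assms(1-3)] by metis
  have "D1 \<noteq> D2"
    using D by blast
  then have "midpoint (incidence_vec D1) (incidence_vec D2)
      \<in> open_segment (incidence_vec D1) (incidence_vec D2)"
    by simp
  moreover have "midpoint (incidence_vec D1) (incidence_vec D2) = midpoint 0 (incidence_vec D)"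
    using D by (simp add: midpoint_def incidence_vec_disjoint_Un)
  moreover have "midpoint 0 (incidence_vec D) \<in> convex hull {0, incidence_vec D}"
    by (simp add: segment_convex_hull[symmetric])
  moreover have "incidence_vec D1 \<in> cut_polytope V E" "incidence_vec D2 \<in> cut_polytope V E"
    using D(1,2) by (auto simp: cut_polytope_def intro: hull_inc)
  ultimately have "incidence_vec D1 \<in> convex hull {0, incidence_vec D}"
    using face_ofD[OF assms(4)] by metis
  then have "D1 = {} \<or> D1 = D"
    by (rule incidence_vec_in_segment_0)
  then show False
    using D by blast
qed

lemma adjacent_vertices_0_iff_bond:
  assumes "simple_graph V E" and "connected_graph V E"
  shows "adjacent_vertices (cut_polytope V E) 0 x \<longleftrightarrow>
           (\<exists>B\<in>bonds V E. B \<noteq> {} \<and> x = incidence_vec B)"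
proof -
  have extreme: "y extreme_point_of cut_polytope V E \<longleftrightarrow> y \<in> incidence_vec ` cuts V E" for y
    by (simp add: cut_polytope_def extreme_point_of_convex_hull_incidence_vec)
  have 0: "0 extreme_point_of cut_polytope V E"
    unfolding extreme using empty_in_bonds[OF assms] bonds_subset_cuts
    by (force simp: image_iff)
  \<comment> \<open>The dimension condition excludes the degenerate pair with \<open>x = 0\<close>,
    that is, the empty bond.\<close>
  have dim: "aff_dim (convex hull {0, x}) = 1 \<longleftrightarrow> x \<noteq> 0"
    by (auto simp: aff_dim_convex_hull)
  show ?thesis
  proof
    assume adj: "adjacent_vertices (cut_polytope V E) 0 x"
    then obtain D where D: "D \<in> cuts V E" "x = incidence_vec D"
      by (auto simp: adjacent_vertices_def extreme)
    then have "D \<in> bonds V E"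
      using adj adjacent_0_imp_bond[OF assms] by (simp add: adjacent_vertices_def)
    moreover have "D \<noteq> {}"
      using adj D(2) dim by (auto simp: adjacent_vertices_def)
    ultimately show "\<exists>B\<in>bonds V E. B \<noteq> {} \<and> x = incidence_vec B"
      using D(2) by blast
  next
    assume "\<exists>B\<in>bonds V E. B \<noteq> {} \<and> x = incidence_vec B"
    then obtain B where B: "B \<in> bonds V E" "B \<noteq> {}" "x = incidence_vec B"
      by blast
    then show "adjacent_vertices (cut_polytope V E) 0 x"
      using 0 dim segment_to_bond_face_of_cut_polytope[OF assms B(1)] bonds_subset_cuts
      by (auto simp: adjacent_vertices_def extreme)
  qed
qed

theorem theorem3p2:
  fixes V :: "'v::finite set" and E :: "'v set set"
  assumes "simple_graph V E" and "connected_graph V E"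
  shows "{x. x extreme_point_of bond_polytope V E}
           = insert 0 {x. adjacent_vertices (cut_polytope V E) 0 x}
       \<and> convex_cone hull (cut_polytope V E) = convex_cone hull (bond_polytope V E)
       \<and> aff_dim (bond_polytope V E) = int (card E)
       \<and> (\<forall>a \<in> edge_space E.
             facet_defining a 0 (bond_polytope V E) \<longleftrightarrow> facet_defining a 0 (cut_polytope V E))"
proof (intro conjI ballI)
  have "{x. x extreme_point_of bond_polytope V E} = incidence_vec ` bonds V E"
    by (simp add: bond_polytope_def extreme_point_of_convex_hull_incidence_vec)
  \<comment> \<open>The empty bond supplies the origin; the nonempty bonds supply its
    neighbours.\<close>
  also have "\<dots> = insert 0 {x. adjacent_vertices (cut_polytope V E) 0 x}"
    using empty_in_bonds[OF assms] incidence_vec_empty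
    by (auto simp: adjacent_vertices_0_iff_bond[OF assms] image_iff)
  finally show "{x. x extreme_point_of bond_polytope V E}
      = insert 0 {x. adjacent_vertices (cut_polytope V E) 0 x}" .
  show "convex_cone hull (cut_polytope V E) = convex_cone hull (bond_polytope V E)"
    by (rule cut_cone_eq_bond_cone[OF assms])
  show "aff_dim (bond_polytope V E) = int (card E)"
    by (rule aff_dim_bond_polytope[OF assms])
  fix a
  have "0 \<in> bond_polytope V E" "0 \<in> cut_polytope V E"
    using zero_in_bond_polytope[OF assms] bond_polytope_subset_cut_polytope by blast+
  then show "facet_defining a 0 (bond_polytope V E) \<longleftrightarrow> facet_defining a 0 (cut_polytope V E)"
    using cut_cone_eq_bond_cone[OF assms]
    by (intro facet_defining_homogeneous_cong)
       (auto simp: bond_polytope_def cut_polytope_def)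
qed

end
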